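(* For all integers $m\ge 1$, the corona $K_2\circ K_m$ has pretty good state transfer between the vertices of $K_2$; that is, if $u,v$ are the two vertices of $K_2$, there is pretty good state transfer between $(u,0)$ and $(v,0)$.
   Context: $K_m$ is the complete graph on $m$ vertices. The corona $G\circ H$ of graphs $G,H$ has vertex set $V(G)\times(\{0\}\cup V(H))$ (where $0\notin V(H)$), and $(v,w)$ is adjacent to $(v',w')$ iff one of the following holds: $w=w'=0$ and $v,v'$ are adjacent in $G$; or $v=v'$ and $w,w'\in V(H)$ are adjacent in $H$; or $v=v'$ and exactly one of $w,w'$ equals $0$. A graph $X$ with adjacency matrix $A(X)$ has pretty good state transfer between vertices $a,b$ if for every $\epsilon>0$ there are a time $\tau$ and a complex number $\gamma$ with $|\gamma|=1$ such that $\|e^{-\mathrm{i}\tau A(X)}e_a-\gamma e_b\|<\epsilon$, where $e_a$ is the standard basis vector indexed by $a$. *)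

theory Defs
  imports "HOL-Analysis.Analysis" "Graph_Theory.Graph_Theory"
begin

text \<open>
  Simple graphs are the loop-free symmetric digraphs (locale \<open>graph\<close>) of \<open>Graph_Theory\<close>, and
  \<open>K\<^bsub>m\<^esub> H\<close> says that \<open>H\<close> is a complete graph on \<open>m\<close> vertices.

  In the corona, \<open>None\<close> plays the role of the extra element \<open>0\<close>, and \<open>Some x\<close> that of
  \<open>x \<in> V(H)\<close>.
\<close>

definition corona ::
  "('a, 'e) pre_digraph \<Rightarrow> ('b, 'f) pre_digraph \<Rightarrow> ('a \<times> 'b option) pair_pre_digraph" where
  "corona G H = (let V = verts G \<times> insert None (Some ` verts H) in
     \<lparr>pverts = V,
      parcs = {((v, w), (v', w')).
        (v, w) \<in> V \<and> (v', w') \<in> V \<and>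
        (w = None \<and> w' = None \<and> v \<rightarrow>\<^bsub>G\<^esub> v' \<or>
         v = v' \<and> (\<exists>x y. w = Some x \<and> w' = Some y \<and> x \<rightarrow>\<^bsub>H\<^esub> y) \<or>
         v = v' \<and> (w = None) \<noteq> (w' = None))}\<rparr>)"

lemma graph_corona:
  assumes "graph G" and "graph H"
  shows "graph (with_proj (corona G H))"
proof -
  interpret G: graph G by fact
  interpret H: graph H by fact
  have fin: "finite (pverts (corona G H))"
    by (simp add: corona_def)
  have sub: "parcs (corona G H) \<subseteq> pverts (corona G H) \<times> pverts (corona G H)"
    by (auto simp: corona_def)
  have "finite (parcs (corona G H))"
    using finite_subset[OF sub] fin by blast
  moreover have "symmetric (with_proj (corona G H))"
  proof -
    have "u \<rightarrow>\<^bsub>G\<^esub> v \<Longrightarrow> v \<rightarrow>\<^bsub>G\<^esub> u" for u v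
      using G.sym_arcs by (auto simp: symmetric_def dest: symD)
    moreover have "x \<rightarrow>\<^bsub>H\<^esub> y \<Longrightarrow> y \<rightarrow>\<^bsub>H\<^esub> x" for x y
      using H.sym_arcs by (auto simp: symmetric_def dest: symD)
    ultimately have "sym (parcs (corona G H))"
      by (auto simp: corona_def Let_def intro!: symI)
    then show ?thesis by (simp add: symmetric_def)
  qed
  moreover have "fst e \<noteq> snd e" if "e \<in> parcs (corona G H)" for e
    using that G.adj_not_same H.adj_not_same by (auto simp: corona_def Let_def)
  ultimately have "pair_graph (corona G H)"
    using sub fin by unfold_locales auto
  then interpret pair_graph "corona G H" .
  show ?thesis by unfold_locales
qed

text \<open>
  Matrices are indexed by the whole (finite) vertex type.  Indices outside \<open>verts X\<close> have zero
  rows and columns, so that the exponential below is the direct sum of the exponential of the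
  adjacency matrix on \<open>verts X\<close> and an identity matrix on the remaining indices.
\<close>

definition adjacency_matrix :: "('v::finite, 'e) pre_digraph \<Rightarrow> complex^'v^'v" where
  "adjacency_matrix X = (\<chi> a b. if a \<rightarrow>\<^bsub>X\<^esub> b then 1 else 0)"

primrec matrix_power :: "complex^'v^'v \<Rightarrow> nat \<Rightarrow> complex^'v^'v" where
  "matrix_power M 0 = mat 1"
| "matrix_power M (Suc k) = M ** matrix_power M k"

definition matrix_exp :: "complex^'v^'v \<Rightarrow> complex^'v^'v" where
  "matrix_exp M = (\<Sum>k. (1 / fact k) *\<^sub>R matrix_power M k)"

definition pretty_good_state_transfer :: "('v::finite, 'e) pre_digraph \<Rightarrow> 'v \<Rightarrow> 'v \<Rightarrow> bool" where
  "pretty_good_state_transfer X a b \<longleftrightarrow>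
     a \<in> verts X \<and> b \<in> verts X \<and>
     (\<forall>\<epsilon>>0. \<exists>(\<tau>::real) (\<gamma>::complex). norm \<gamma> = 1 \<and>
        norm (matrix_exp (map_matrix ((*) (- \<i> * of_real \<tau>)) (adjacency_matrix X)) *v axis a 1
              - \<gamma> *s axis b 1) < \<epsilon>)"

end

theory Submission
  imports Defs
begin

text \<open>
  Write \<open>A\<close> for the adjacency matrix of the corona. For \<open>l = \<plusminus>1\<close>, the vectors that are constant on each
  of the two copies of \<open>H\<close>, and whose entries at \<open>v\<close> and its copy of \<open>H\<close> are \<open>l\<close> times those at \<open>u\<close>
  and its copy, form a two-dimensional invariant subspace of \<open>A\<close>. In terms of the value \<open>p\<close> at
  \<open>(u, None)\<close> and the value \<open>q\<close> on the copy of \<open>H\<close> at \<open>u\<close>, the matrix acts there by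
  \<open>(p, q) \<mapsto> (l p + m q, p + (m - 1) q)\<close>, with the two eigenvalues
  \<open>\<mu> = (l + m - 1 \<plusminus> d\<^sub>l) / 2\<close>, where \<open>d\<^sub>l = sqrt ((m - 1 - l)\<^sup>2 + 4 m)\<close>; that is, \<open>sqrt (m\<^sup>2 + 4)\<close> for
  \<open>l = 1\<close> and \<open>sqrt (m\<^sup>2 + 4 m)\<close> for \<open>l = -1\<close>. The basis vector at \<open>(u, None)\<close> is a sum of four such
  eigenvectors, one for each \<open>\<mu>\<close>, and multiplying the two with \<open>l = -1\<close> by \<open>-1\<close> turns the sum into
  the basis vector at \<open>(v, None)\<close>. So pretty good state transfer follows once, for suitable \<open>\<tau>\<close> and
  \<open>\<gamma>\<close>, each of the four numbers \<open>exp (- \<i> \<tau> \<mu>)\<close> is close to \<open>l \<gamma>\<close>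
  (\<open>pretty_good_state_transferI_eigenvectors\<close>).

  Take \<open>\<tau> = n \<pi>\<close> with \<open>n\<close> odd and \<open>\<gamma> = exp (- \<i> \<pi> n m / 2)\<close>. The summand \<open>l - 1\<close> in \<open>2 \<mu>\<close> then contributes
  exactly the sign \<open>l\<close>, and what remains is that \<open>n d\<^sub>1\<close> and \<open>n d\<^bsub>-1\<^esub>\<close> both be close to multiples of 4
  (\<open>phase_difference_le\<close>). Both square roots are irrational since \<open>m \<ge> 1\<close>. If their product is irrational
  too, then 1 and the two roots are linearly independent over the integers, and such an \<open>n\<close> exists
  by the two-dimensional Kronecker theorem. Otherwise (for instance \<open>m = 1\<close>, where both are
  \<open>sqrt 5\<close>) they are rational multiples of one another, and the one-dimensional Kronecker theorem
  suffices (\<open>odd_multiples_near_multiples_of_4\<close>).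
\<close>

section \<open>Odd multiples of quadratic irrationals near multiples of 4\<close>

lemma sqrt_of_nat_rational_imp_square:
  assumes "sqrt (real n) \<in> \<rat>"
  shows "\<exists>k. n = k\<^sup>2"
proof -
  have "algebraic_int (sqrt (real n))"
    by (intro algebraic_int_sqrt int_imp_algebraic_int) simp
  then have "sqrt (real n) \<in> \<int>"
    using assms rational_algebraic_int_is_int by blast
  then obtain z :: int where z: "sqrt (real n) = of_int z"
    by (auto elim: Ints_cases)
  then have "z \<ge> 0"
    by (metis of_int_0_le_iff of_nat_0_le_iff real_sqrt_ge_zero)
  then have "sqrt (real n) = real (nat z)"
    using z by simp
  then have "real n = (real (nat z))\<^sup>2"
    by (metis of_nat_0_le_iff real_sqrt_pow2)
  then have "n = (nat z)\<^sup>2"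
    by (metis of_nat_eq_iff of_nat_power)
  then show ?thesis by blast
qed

lemma sqrt_square_plus_4_irrational:
  assumes "m \<ge> 1"
  shows "sqrt (real (m\<^sup>2 + 4)) \<notin> \<rat>"
proof
  assume "sqrt (real (m\<^sup>2 + 4)) \<in> \<rat>"
  then obtain k where k: "m\<^sup>2 + 4 = k\<^sup>2"
    using sqrt_of_nat_rational_imp_square by blast
  consider "k \<le> m" | "k = m + 1" | "k \<ge> m + 2" by linarith
  then show False
  proof cases
    case 1
    then have "k\<^sup>2 \<le> m\<^sup>2" by (simp add: power_mono)
    then show ?thesis using k by linarith
  next
    case 2
    with k have "4 = 2 * m + 1" by (simp add: power2_eq_square)
    then show ?thesis by presburger
  next
    case 3
    then have "(m + 2)\<^sup>2 \<le> k\<^sup>2" by (simp add: power_mono)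
    then show ?thesis using k assms by (simp add: power2_eq_square)
  qed
qed

lemma sqrt_square_plus_4_times_irrational:
  assumes "m \<ge> 1"
  shows "sqrt (real (m\<^sup>2 + 4 * m)) \<notin> \<rat>"
proof
  assume "sqrt (real (m\<^sup>2 + 4 * m)) \<in> \<rat>"
  then obtain k where k: "m\<^sup>2 + 4 * m = k\<^sup>2"
    using sqrt_of_nat_rational_imp_square by blast
  consider "k \<le> m" | "k = m + 1" | "k \<ge> m + 2" by linarith
  then show False
  proof cases
    case 1
    then have "k\<^sup>2 \<le> m\<^sup>2" by (simp add: power_mono)
    then show ?thesis using k assms by linarith
  next
    case 2
    with k have "4 * m = 2 * m + 1" by (simp add: power2_eq_square)
    then show ?thesis by presburger
  next
    case 3
    then have "(m + 2)\<^sup>2 \<le> k\<^sup>2" by (simp add: power_mono)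
    then show ?thesis using k assms by (simp add: power2_eq_square)
  qed
qed

text \<open>
  Squaring a relation \<open>a \<alpha> + b \<beta> = - c\<close> makes \<open>2 a b \<alpha> \<beta>\<close> rational, so \<open>a = 0\<close> or \<open>b = 0\<close>; the
  irrationality of \<open>\<alpha>\<close> and \<open>\<beta>\<close> then removes the remaining terms.
\<close>

lemma no_integer_relation_quadratic_irrationals:
  fixes \<alpha> \<beta> :: real and a b c :: int
  assumes \<alpha>: "\<alpha> \<notin> \<rat>" "\<alpha>\<^sup>2 \<in> \<rat>" and \<beta>: "\<beta> \<notin> \<rat>" "\<beta>\<^sup>2 \<in> \<rat>"
    and \<alpha>\<beta>: "\<alpha> * \<beta> \<notin> \<rat>"
    and rel: "of_int a * \<alpha> + of_int b * \<beta> + of_int c = 0"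
  shows "a = 0 \<and> b = 0 \<and> c = 0"
proof -
  have "of_int (2 * a * b) * (\<alpha> * \<beta>) = (of_int c)\<^sup>2 - (of_int a)\<^sup>2 * \<alpha>\<^sup>2 - (of_int b)\<^sup>2 * \<beta>\<^sup>2"
  proof -
    have c: "of_int c = - (of_int a * \<alpha> + of_int b * \<beta>)" using rel by linarith
    show ?thesis unfolding c by (simp add: power2_eq_square algebra_simps)
  qed
  also have "\<dots> \<in> \<rat>" using \<alpha>(2) \<beta>(2) by simp
  finally have 1: "of_int (2 * a * b) * (\<alpha> * \<beta>) \<in> \<rat>" .
  have nz: "x \<in> \<rat>" if "of_int k * x \<in> \<rat>" "k \<noteq> 0" for x :: real and k :: int
    using Rats_divide[OF that(1) Rats_of_int[of k]] that(2) by simp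
  have "2 * a * b = 0" using nz[OF 1] \<alpha>\<beta> by blast
  then have "a = 0 \<or> b = 0" by simp
  moreover have "b = 0" if "a = 0"
  proof (rule ccontr)
    assume "b \<noteq> 0"
    moreover have "of_int b * \<beta> = of_int (- c)" using rel that by simp
    ultimately show False using nz[of b \<beta>] \<beta>(1) by (metis Rats_of_int)
  qed
  moreover have "a = 0" if "b = 0"
  proof (rule ccontr)
    assume "a \<noteq> 0"
    moreover have "of_int a * \<alpha> = of_int (- c)" using rel that by simp
    ultimately show False using nz[of a \<alpha>] \<alpha>(1) by (metis Rats_of_int)
  qed
  ultimately have "a = 0" "b = 0" by blast+
  with rel show ?thesis by simp
qed

text \<open>
  Kronecker's theorem for odd multipliers \<open>2 k + 1\<close>. Asking that \<open>(2 k + 1) \<alpha>\<close> be near \<open>4 h\<close> is asking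
  that \<open>k \<alpha> / 2\<close> be near \<open>- \<alpha> / 4\<close> modulo 1, an inhomogeneous approximation problem in \<open>k\<close>. The only
  integer relation between \<open>\<alpha>\<close>, \<open>\<beta>\<close> and 1 that can occur is one between \<open>\<alpha>\<close> and \<open>\<beta>\<close>, and that one is
  no obstruction.
\<close>

lemma odd_multiples_near_multiples_of_4:
  fixes \<alpha> \<beta> \<delta> :: real
  assumes \<alpha>: "\<alpha> \<notin> \<rat>" "\<alpha>\<^sup>2 \<in> \<rat>" and \<beta>: "\<beta> \<notin> \<rat>" "\<beta>\<^sup>2 \<in> \<rat>" and "\<delta> > 0"
  obtains n h k :: int
  where "odd n" "\<bar>of_int n * \<alpha> - 4 * of_int h\<bar> < \<delta>" "\<bar>of_int n * \<beta> - 4 * of_int k\<bar> < \<delta>"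
proof (cases "\<alpha> * \<beta> \<in> \<rat>")
  case True
  have \<alpha>0: "\<alpha> \<noteq> 0" using \<alpha>(1) by auto
  have "\<beta> / \<alpha> = \<alpha> * \<beta> / \<alpha>\<^sup>2" using \<alpha>0 by (simp add: power2_eq_square)
  then have "\<beta> / \<alpha> \<in> \<rat>" using True \<alpha>(2) by simp
  then obtain p q :: int where q: "q > 0" and pq: "\<beta> / \<alpha> = of_int p / of_int q"
    by (auto elim: Rats_cases')
  have \<beta>eq: "\<beta> = of_int p / of_int q * \<alpha>" using pq \<alpha>0 by (simp add: field_simps)
  \<comment> \<open>As \<open>\<beta> = p \<alpha> / q\<close>, it is enough that \<open>n \<alpha>\<close> be very close to a multiple \<open>4 q h\<close> of \<open>4 q\<close>.\<close>
  define C :: real where "C = 4 * (of_int q + \<bar>of_int p\<bar>)"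
  have C: "C > 0" using q by (simp add: C_def add_pos_nonneg)
  have irr: "\<alpha> / of_int (2 * q) \<notin> \<rat>"
  proof
    assume "\<alpha> / of_int (2 * q) \<in> \<rat>"
    then have "\<alpha> / of_int (2 * q) * of_int (2 * q) \<in> \<rat>" by (rule Rats_mult) simp
    then show False using \<alpha>(1) q by simp
  qed
  obtain h k :: int where "\<bar>of_int k * (\<alpha> / of_int (2 * q)) - of_int h - (- \<alpha> / of_int (4 * q))\<bar> < \<delta> / C"
    using sequence_of_fractional_parts_is_dense[OF irr, of "\<delta> / C" "- \<alpha> / of_int (4 * q)"]
      \<open>\<delta> > 0\<close> C by (metis divide_pos_pos)
  moreover define e where "e = of_int (2 * k + 1) * \<alpha> - 4 * of_int (q * h)"
  have "of_int k * (\<alpha> / of_int (2 * q)) - of_int h - (- \<alpha> / of_int (4 * q)) = e / (4 * of_int q)"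
    using q by (simp add: e_def field_simps)
  ultimately have "\<bar>e\<bar> / (4 * of_int q) < \<delta> / C" using q by (simp add: abs_mult)
  then have e: "\<bar>e\<bar> * C < \<delta> * (4 * of_int q)" using C q by (simp add: field_simps)
  have "\<bar>e\<bar> * (4 * of_int q) \<le> \<bar>e\<bar> * C" by (intro mult_left_mono) (auto simp: C_def)
  with e have "\<bar>e\<bar> * (4 * of_int q) < \<delta> * (4 * of_int q)" by linarith
  then have e1: "\<bar>e\<bar> < \<delta>" using q by simp
  have "\<bar>e\<bar> * (4 * \<bar>of_int p\<bar>) \<le> \<bar>e\<bar> * C" using q by (intro mult_left_mono) (auto simp: C_def)
  with e have "\<bar>e\<bar> * (4 * \<bar>of_int p\<bar>) < \<delta> * (4 * of_int q)" by linarith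
  then have e2: "\<bar>e\<bar> * \<bar>of_int p\<bar> / of_int q < \<delta>" using q by (simp add: field_simps)
  have "of_int (2 * k + 1) * \<beta> - 4 * of_int (p * h) = e * of_int p / of_int q"
    using q by (simp add: e_def \<beta>eq field_simps)
  then have "\<bar>of_int (2 * k + 1) * \<beta> - 4 * of_int (p * h)\<bar> < \<delta>"
    using e2 q by (simp add: abs_mult)
  moreover have "odd (2 * k + 1)" by simp
  ultimately show thesis using that[of "2 * k + 1" "q * h" "p * h"] e1 by (simp add: e_def)
next
  case False
  interpret Modules.module "\<lambda>r. (*) (real_of_int r)"
    by (simp add: Modules.module.intro distrib_left mult.commute)
  define \<theta> :: "nat \<Rightarrow> real" where "\<theta> = (\<lambda>i. if i = 0 then \<alpha> / 2 else if i = 1 then \<beta> / 2 else 1)"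
  have ne: "\<alpha> \<noteq> \<beta>" using False \<alpha>(2) by (auto simp: power2_eq_square)
  have "\<alpha> \<noteq> 2" "\<beta> \<noteq> 2" using \<alpha>(1) \<beta>(1) by auto
  with ne have inj: "inj_on \<theta> {..2}" and dist: "\<alpha> / 2 \<notin> {\<beta> / 2, 1}" "\<beta> / 2 \<notin> {1}"
    by (auto simp: inj_on_def \<theta>_def split: if_splits)
  have img: "\<theta> ` {..2} = {\<alpha> / 2, \<beta> / 2, 1}"
    by (auto simp: \<theta>_def numeral_2_eq_2 atMost_Suc)
  have ind: "independent (\<theta> ` {..2})"
  proof
    assume "dependent (\<theta> ` {..2})"
    then obtain w v where v: "v \<in> \<theta> ` {..2}" "w v \<noteq> 0"
      and sum: "(\<Sum>v\<in>\<theta> ` {..2}. of_int (w v) * v) = 0"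
      using dependent_finite[of "\<theta> ` {..2}"] by auto
    have "of_int (w (\<alpha> / 2)) * (\<alpha> / 2) + (of_int (w (\<beta> / 2)) * (\<beta> / 2) + of_int (w 1)) = 0"
      using sum dist unfolding img by simp
    then have "of_int (w (\<alpha> / 2)) * \<alpha> + of_int (w (\<beta> / 2)) * \<beta> + of_int (2 * w 1) = 0"
      by simp
    from no_integer_relation_quadratic_irrationals[OF \<alpha> \<beta> False this] v img
    show False by auto
  qed
  obtain k h where kh: "\<And>i. i < 2 \<Longrightarrow> \<bar>of_int k * \<theta> i - of_int (h i) - (- \<theta> i / 2)\<bar> < \<delta> / 4"
    using Kronecker_thm_2[OF ind inj, of "\<delta> / 4" "\<lambda>i. - \<theta> i / 2"] \<open>\<delta> > 0\<close> by (auto simp: \<theta>_def)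
  have "\<bar>of_int (2 * k + 1) * \<alpha> - 4 * of_int (h 0)\<bar> < \<delta>"
    using kh[of 0] unfolding abs_less_iff \<theta>_def by (simp add: algebra_simps)
  moreover have "\<bar>of_int (2 * k + 1) * \<beta> - 4 * of_int (h 1)\<bar> < \<delta>"
    using kh[of 1] unfolding abs_less_iff \<theta>_def by (simp add: algebra_simps)
  moreover have "odd (2 * k + 1)" by simp
  ultimately show thesis using that by blast
qed

section \<open>The matrix exponential on eigenvectors\<close>

lemma bounded_bilinear_matrix_mult:
  "bounded_bilinear ((**) :: complex^'n^'n \<Rightarrow> complex^'n^'n \<Rightarrow> complex^'n^'n)"
proof (rule bilinear_conv_bounded_bilinear[THEN iffD1], unfold bilinear_def, intro conjI allI linearI)
  fix A B C :: "complex^'n^'n" and r :: real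
  show "A ** (B + C) = A ** B + A ** C"
    by (rule matrix_add_ldistrib)
  show "(A + B) ** C = A ** C + B ** C"
    unfolding matrix_matrix_mult_def by (simp add: vec_eq_iff distrib_right sum.distrib)
  show "A ** (r *\<^sub>R B) = r *\<^sub>R (A ** B)" "(r *\<^sub>R A) ** B = r *\<^sub>R (A ** B)"
    unfolding matrix_matrix_mult_def by (simp_all add: vec_eq_iff scaleR_sum_right)
qed

lemma bounded_linear_matrix_vector_mult_left:
  "bounded_linear (\<lambda>M :: complex^'n^'n. M *v x)"
proof (rule linear_conv_bounded_linear[THEN iffD1], rule linearI)
  fix A B :: "complex^'n^'n" and r :: real
  show "(A + B) *v x = A *v x + B *v x"
    by (rule matrix_vector_mult_add_rdistrib)
  show "(r *\<^sub>R A) *v x = r *\<^sub>R (A *v x)"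
    unfolding matrix_vector_mult_def by (simp add: vec_eq_iff scaleR_sum_right)
qed

lemma bounded_linear_vector_scalar_mult_left:
  "bounded_linear (\<lambda>c :: complex. c *s (x :: complex^'n))"
  by (rule linear_conv_bounded_linear[THEN iffD1], rule linearI)
    (simp_all add: vec_eq_iff distrib_right)

text \<open>
  The norm on matrices here is the Euclidean norm of the entries; for summability it only matters that
  matrix multiplication is bounded bilinear.
\<close>

lemma summable_matrix_exp:
  "summable (\<lambda>k. (1 / fact k) *\<^sub>R matrix_power (M :: complex^'n^'n) k)"
proof -
  obtain K where K: "K > 0"
    "\<And>(A :: complex^'n^'n) (B :: complex^'n^'n). norm (A ** B) \<le> norm A * norm B * K"
    using bounded_bilinear.pos_bounded[OF bounded_bilinear_matrix_mult] by blast
  have pow: "norm (matrix_power M k) \<le> norm (mat 1 :: complex^'n^'n) * (norm M * K) ^ k" for k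
  proof (induction k)
    case (Suc k)
    have "norm (matrix_power M (Suc k)) \<le> norm M * norm (matrix_power M k) * K"
      using K(2) by simp
    also have "\<dots> = (norm M * K) * norm (matrix_power M k)" by simp
    also have "\<dots> \<le> (norm M * K) * (norm (mat 1 :: complex^'n^'n) * (norm M * K) ^ k)"
      using Suc K(1) by (intro mult_left_mono) auto
    finally show ?case by (simp add: algebra_simps)
  qed simp
  show ?thesis
  proof (rule summable_comparison_test')
    show "summable (\<lambda>k. norm (mat 1 :: complex^'n^'n) * (inverse (fact k) * (norm M * K) ^ k))"
      by (intro summable_mult summable_exp)
    show "norm ((1 / fact k) *\<^sub>R matrix_power M k)
        \<le> norm (mat 1 :: complex^'n^'n) * (inverse (fact k) * (norm M * K) ^ k)" for k
      using pow[of k] by (simp add: field_simps)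
  qed
qed

lemma matrix_power_eigenvector:
  assumes "M *v x = \<mu> *s x"
  shows "matrix_power M k *v x = \<mu> ^ k *s x"
proof (induction k)
  case (Suc k)
  have "matrix_power M (Suc k) *v x = M *v (\<mu> ^ k *s x)"
    using Suc by (simp add: matrix_vector_mul_assoc[symmetric])
  also have "\<dots> = \<mu> ^ k *s (M *v x)"
    by (simp add: vec.scale)
  finally show ?case using assms by (simp add: mult.commute)
qed simp

lemma matrix_exp_eigenvector:
  fixes M :: "complex^'n^'n"
  assumes "M *v x = \<mu> *s x"
  shows "matrix_exp M *v x = exp \<mu> *s x"
proof (rule sums_unique2)
  have "(\<lambda>k. (1 / fact k) *\<^sub>R matrix_power M k) sums matrix_exp M"
    unfolding matrix_exp_def using summable_matrix_exp by (rule summable_sums)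
  from bounded_linear.sums[OF bounded_linear_matrix_vector_mult_left this]
  show "(\<lambda>k. ((1 / fact k) *\<^sub>R matrix_power M k) *v x) sums (matrix_exp M *v x)" .
  have "((1 / fact k) *\<^sub>R matrix_power M k) *v x = (\<mu> ^ k /\<^sub>R fact k) *s x" for k
  proof -
    have "((1 / fact k) *\<^sub>R matrix_power M k) *v x = (1 / fact k) *\<^sub>R (matrix_power M k *v x)"
      by (rule linear_cmul[OF bounded_linear.linear[OF bounded_linear_matrix_vector_mult_left]])
    then show ?thesis
      by (simp add: matrix_power_eigenvector[OF assms] vec_eq_iff divide_inverse)
  qed
  then show "(\<lambda>k. ((1 / fact k) *\<^sub>R matrix_power M k) *v x) sums (exp \<mu> *s x)"
    using bounded_linear.sums[OF bounded_linear_vector_scalar_mult_left exp_converges[of \<mu>]]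
    by simp
qed

lemma norm_vector_scalar_mult: "norm (c *s (x :: complex^'n)) = norm c * norm x"
  by (simp add: norm_vec_def norm_mult L2_set_right_distrib)

text \<open>
  The vectors \<open>f j\<close> need not form a basis, nor be orthogonal, and the \<open>\<mu> j\<close> need not be distinct: all that
  matters is that the two basis vectors are combinations of the same eigenvectors, and that at some
  time all phases come close to the coefficients \<open>\<sigma> j\<close>, up to the global phase \<open>\<gamma>\<close>.
\<close>

lemma pretty_good_state_transferI_eigenvectors:
  fixes X :: "('v::finite, 'e) pre_digraph" and f :: "'j \<Rightarrow> complex^'v"
    and \<mu> :: "'j \<Rightarrow> real" and \<sigma> :: "'j \<Rightarrow> complex"
  assumes "a \<in> verts X" "b \<in> verts X"
    and eig: "\<And>j. j \<in> J \<Longrightarrow> adjacency_matrix X *v f j = of_real (\<mu> j) *s f j"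
    and a: "axis a 1 = (\<Sum>j\<in>J. f j)"
    and b: "axis b 1 = (\<Sum>j\<in>J. \<sigma> j *s f j)"
    and phase: "\<And>\<delta>. \<delta> > 0 \<Longrightarrow> \<exists>(\<tau>::real) (\<gamma>::complex). norm \<gamma> = 1 \<and>
      (\<forall>j\<in>J. norm (exp (- \<i> * of_real \<tau> * of_real (\<mu> j)) - \<gamma> * \<sigma> j) \<le> \<delta>)"
  shows "pretty_good_state_transfer X a b"
  unfolding pretty_good_state_transfer_def
proof (intro conjI allI impI)
  fix \<epsilon> :: real assume "\<epsilon> > 0"
  define C where "C = (\<Sum>j\<in>J. norm (f j)) + 1"
  have C: "C > 0" by (auto simp: C_def intro!: add_nonneg_pos sum_nonneg)
  obtain \<tau> :: real and \<gamma> :: complex where \<gamma>: "norm \<gamma> = 1"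
    and near: "\<And>j. j \<in> J \<Longrightarrow> norm (exp (- \<i> * of_real \<tau> * of_real (\<mu> j)) - \<gamma> * \<sigma> j) \<le> \<epsilon> / C"
    using phase[of "\<epsilon> / C"] \<open>\<epsilon> > 0\<close> C by auto
  define U where "U = matrix_exp (map_matrix ((*) (- \<i> * of_real \<tau>)) (adjacency_matrix X))"
  have U: "U *v f j = exp (- \<i> * of_real \<tau> * of_real (\<mu> j)) *s f j" if "j \<in> J" for j
    unfolding U_def
  proof (rule matrix_exp_eigenvector)
    have "map_matrix ((*) c) A *v x = c *s (A *v x)" for c and A :: "complex^'v^'v" and x
      by (simp add: vec_eq_iff matrix_vector_mult_def map_matrix_def sum_distrib_left mult.assoc)
    then show "map_matrix ((*) (- \<i> * of_real \<tau>)) (adjacency_matrix X) *v f j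
        = (- \<i> * of_real \<tau> * of_real (\<mu> j)) *s f j"
      using eig[OF that] by simp
  qed
  have "U *v axis a 1 - \<gamma> *s axis b 1 =
      (\<Sum>j\<in>J. exp (- \<i> * of_real \<tau> * of_real (\<mu> j)) *s f j) - \<gamma> *s (\<Sum>j\<in>J. \<sigma> j *s f j)"
    unfolding a b using U by (simp add: vec.linear_sum[OF matrix_vector_mul_linear_gen])
  also have "\<dots> = (\<Sum>j\<in>J. (exp (- \<i> * of_real \<tau> * of_real (\<mu> j)) - \<gamma> * \<sigma> j) *s f j)"
    by (simp add: vec.scale_sum_right sum_subtractf[symmetric] vec.scale_left_diff_distrib)
  finally have "norm (U *v axis a 1 - \<gamma> *s axis b 1)
      \<le> (\<Sum>j\<in>J. norm (exp (- \<i> * of_real \<tau> * of_real (\<mu> j)) - \<gamma> * \<sigma> j) * norm (f j))"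
    by (simp only: norm_vector_scalar_mult[symmetric] norm_sum)
  also have "\<dots> \<le> (\<Sum>j\<in>J. \<epsilon> / C * norm (f j))"
    using near by (intro sum_mono mult_right_mono) auto
  also have "\<dots> = \<epsilon> / C * (C - 1)" by (simp add: C_def sum_distrib_left)
  also have "\<dots> < \<epsilon>" using C \<open>\<epsilon> > 0\<close> by (simp add: field_simps)
  finally show "\<exists>(\<tau>::real) (\<gamma>::complex). norm \<gamma> = 1 \<and>
      norm (matrix_exp (map_matrix ((*) (- \<i> * of_real \<tau>)) (adjacency_matrix X)) *v axis a 1
        - \<gamma> *s axis b 1) < \<epsilon>"
    unfolding U_def using \<gamma> by (intro exI[of _ \<tau>] exI[of _ \<gamma>] conjI)
qed (use assms(1,2) in simp_all)

section \<open>Eigenvectors of the corona\<close>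

text \<open>
  The vector on the vertices of the corona that takes the values \<open>p\<close> at \<open>(u, None)\<close> and \<open>q\<close> on the copy
  of the vertex set \<open>B\<close> attached to \<open>u\<close>, and \<open>l\<close> times these values at \<open>v\<close>. It vanishes at all
  other elements of the type, in particular, for \<open>B = verts H\<close>, at those that are not vertices.
\<close>

definition corona_vector ::
  "'a \<Rightarrow> 'a \<Rightarrow> 'b set \<Rightarrow> real \<Rightarrow> real \<Rightarrow> real \<Rightarrow> complex^('a::finite \<times> 'b::finite option)" where
  "corona_vector u v B l p q = (\<chi> a.
     of_real ((if fst a = u then 1 else if fst a = v then l else 0) *
       (case snd a of None \<Rightarrow> p | Some x \<Rightarrow> if x \<in> B then q else 0)))"

lemma adjacency_matrix_vector_mult:
  "(adjacency_matrix X *v f) $ a = (\<Sum>b | a \<rightarrow>\<^bsub>X\<^esub> b. f $ b)"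
proof -
  have "(adjacency_matrix X *v f) $ a = (\<Sum>b\<in>UNIV. if a \<rightarrow>\<^bsub>X\<^esub> b then f $ b else 0)"
    unfolding adjacency_matrix_def matrix_vector_mult_def by (auto intro!: sum.cong)
  also have "\<dots> = (\<Sum>b | a \<rightarrow>\<^bsub>X\<^esub> b. f $ b)"
    using sum.inter_filter[of UNIV "\<lambda>b. f $ b" "\<lambda>b. a \<rightarrow>\<^bsub>X\<^esub> b"] by simp
  finally show ?thesis .
qed

text \<open>
  The hypotheses on \<open>p\<close> and \<open>q\<close> are the eigenvalue equation of the \<open>2 \<times> 2\<close> matrix by which the adjacency
  matrix acts on the vectors \<open>corona_vector u v (verts H) l p q\<close>.
\<close>

lemma corona_vector_eigenvector:
  fixes G :: "('a::finite, 'e) pre_digraph" and H :: "('b::finite, 'f) pre_digraph"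
  assumes G: "K\<^bsub>2\<^esub> G" and H: "K\<^bsub>m\<^esub> H" and uv: "verts G = {u, v}"
    and l: "l\<^sup>2 = 1"
    and p: "l * p + real m * q = \<mu> * p" and q: "p + (real m - 1) * q = \<mu> * q"
  shows "adjacency_matrix (with_proj (corona G H)) *v corona_vector u v (verts H) l p q
    = of_real \<mu> *s corona_vector u v (verts H) l p q"
proof -
  let ?X = "with_proj (corona G H)" and ?f = "corona_vector u v (verts H) l p q"
  let ?s = "\<lambda>w. if w = u then 1 else if w = v then l else 0"
  have "card {u, v} = 2" using G uv by (simp add: complete_digraph_def)
  then have "u \<noteq> v" by auto
  have arcsG: "arcs_ends G = {(w, w'). (w, w') \<in> verts G \<times> verts G \<and> w \<noteq> w'}"
    using G unfolding complete_digraph_def by blast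
  have arcsH: "arcs_ends H = {(x, y). (x, y) \<in> verts H \<times> verts H \<and> x \<noteq> y}"
    using H unfolding complete_digraph_def by blast
  have adjG: "w \<rightarrow>\<^bsub>G\<^esub> w' \<longleftrightarrow> w \<in> {u, v} \<and> w' \<in> {u, v} \<and> w \<noteq> w'" for w w'
    unfolding arcsG uv by auto
  have adjH: "x \<rightarrow>\<^bsub>H\<^esub> y \<longleftrightarrow> x \<in> verts H \<and> y \<in> verts H \<and> x \<noteq> y" for x y
    unfolding arcsH by simp
  have card: "card (verts H) = m" using H by (simp add: complete_digraph_def)
  have adj: "(w, z) \<rightarrow>\<^bsub>?X\<^esub> b \<longleftrightarrow> ((w, z), b) \<in> parcs (corona G H)" for w z b
    by simp
  have None: "{b. (w, None) \<rightarrow>\<^bsub>?X\<^esub> b} = insert (w', None) ((\<lambda>x. (w, Some x)) ` verts H)"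
    if "{w, w'} = {u, v}" for w w'
    using that \<open>u \<noteq> v\<close> by (auto simp: adj corona_def uv adjG adjH doubleton_eq_iff)
  have Some: "{b. (w, Some x) \<rightarrow>\<^bsub>?X\<^esub> b} = insert (w, None) ((\<lambda>x. (w, Some x)) ` (verts H - {x}))"
    if "w \<in> {u, v}" "x \<in> verts H" for w x
    using that by (auto simp: adj corona_def uv adjG adjH)
  have Out: "{b. (w, z) \<rightarrow>\<^bsub>?X\<^esub> b} = {}" if "(w, z) \<notin> {u, v} \<times> insert None (Some ` verts H)" for w z
    using that by (auto simp: adj corona_def uv)
  have fN: "?f $ (w, None) = of_real (?s w * p)" for w
    by (simp add: corona_vector_def)
  have fS: "?f $ (w, Some x) = of_real (?s w * q)" if "x \<in> verts H" for w x
    using that by (simp add: corona_vector_def)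
  have sumS: "(\<Sum>b\<in>(\<lambda>x. (w, Some x)) ` S. ?f $ b) = of_nat (card S) * of_real (?s w * q)"
    if "S \<subseteq> verts H" for w S
    using that fS by (subst sum.reindex) (auto simp: inj_on_def subset_iff)
  show ?thesis
  proof (rule vec_eq_iff[THEN iffD2], rule allI, clarify)
    fix w z
    consider (N) w' where "z = None" "{w, w'} = {u, v}"
      | (S) x where "z = Some x" "w \<in> {u, v}" "x \<in> verts H"
      | (O) "(w, z) \<notin> {u, v} \<times> insert None (Some ` verts H)"
      by (cases z) auto
    then show "(adjacency_matrix ?X *v ?f) $ (w, z) = (of_real \<mu> *s ?f) $ (w, z)"
    proof cases
      case N
      have "?s w' = l * ?s w"
        using N(2) \<open>u \<noteq> v\<close> l by (auto simp: doubleton_eq_iff power2_eq_square)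
      have "(adjacency_matrix ?X *v ?f) $ (w, z) = of_real (?s w' * p) + of_nat m * of_real (?s w * q)"
        unfolding adjacency_matrix_vector_mult N(1) None[OF N(2)]
        by (subst sum.insert) (auto simp: fN sumS card)
      also have "\<dots> = of_real (?s w * (l * p + real m * q))"
        unfolding \<open>?s w' = l * ?s w\<close> by (simp add: algebra_simps)
      also have "\<dots> = (of_real \<mu> *s ?f) $ (w, z)"
        unfolding p by (simp add: N(1) fN)
      finally show ?thesis .
    next
      case S
      have "m \<ge> 1" using S(3) card by (metis One_nat_def Suc_leI card_gt_0_iff empty_iff finite)
      have "(adjacency_matrix ?X *v ?f) $ (w, z) = of_real (?s w * p) + of_nat (m - 1) * of_real (?s w * q)"
        unfolding adjacency_matrix_vector_mult S(1) Some[OF S(2,3)]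
        using S(3) by (subst sum.insert) (auto simp: fN sumS card)
      also have "\<dots> = of_real (?s w * (p + (real m - 1) * q))"
        using \<open>m \<ge> 1\<close> by (simp add: algebra_simps of_nat_diff)
      also have "\<dots> = (of_real \<mu> *s ?f) $ (w, z)"
        unfolding q by (simp add: S fS)
      finally show ?thesis .
    next
      case O
      then have "?f $ (w, z) = 0"
        by (auto simp: corona_vector_def split: option.splits)
      then show ?thesis
        unfolding adjacency_matrix_vector_mult Out[OF O] by simp
    qed
  qed
qed

lemma corona_vector_None [simp]:
  "corona_vector u v B l p q $ (w, None) = of_real ((if w = u then 1 else if w = v then l else 0) * p)"
  by (simp add: corona_vector_def)

lemma corona_vector_Some [simp]:
  "corona_vector u v B l p q $ (w, Some x) =
    of_real ((if w = u then 1 else if w = v then l else 0) * (if x \<in> B then q else 0))"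
  by (simp add: corona_vector_def)

lemma corona_vector_add:
  "corona_vector u v B l p q + corona_vector u v B l p' q' = corona_vector u v B l (p + p') (q + q')"
proof (rule vec_eq_iff[THEN iffD2], rule allI, clarify)
  fix w z
  show "(corona_vector u v B l p q + corona_vector u v B l p' q') $ (w, z)
      = corona_vector u v B l (p + p') (q + q') $ (w, z)"
    by (cases z) (simp_all add: distrib_left)
qed

lemma axis_eq_corona_vector:
  assumes "u \<noteq> v"
  shows "axis (u, None) 1 = corona_vector u v B 1 (1/2) 0 + corona_vector u v B (-1) (1/2) 0"
    and "axis (v, None) 1 = corona_vector u v B 1 (1/2) 0 - corona_vector u v B (-1) (1/2) 0"
proof -
  have "axis (u, None) 1 $ (w, z)
      = (corona_vector u v B 1 (1/2) 0 + corona_vector u v B (-1) (1/2) 0) $ (w, z)" for w z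
    using assms by (cases z) (simp_all add: axis_def)
  then show "axis (u, None) 1 = corona_vector u v B 1 (1/2) 0 + corona_vector u v B (-1) (1/2) 0"
    by (intro vec_eq_iff[THEN iffD2] allI) (metis surj_pair)
  have "axis (v, None) 1 $ (w, z)
      = (corona_vector u v B 1 (1/2) 0 - corona_vector u v B (-1) (1/2) 0) $ (w, z)" for w z
    using assms by (cases z) (simp_all add: axis_def)
  then show "axis (v, None) 1 = corona_vector u v B 1 (1/2) 0 - corona_vector u v B (-1) (1/2) 0"
    by (intro vec_eq_iff[THEN iffD2] allI) (metis surj_pair)
qed

section \<open>State transfer at odd multiples of \<pi>\<close>

text \<open>
  The second exponential is the phase \<open>\<gamma>\<close>, for \<open>c = m\<close>. For odd \<open>n\<close>, \<open>exp (- \<i> \<pi> n (l - 1) / 2) = l\<close>, so the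
  phases differ by the factor \<open>exp (- \<i> \<pi> s n d / 2)\<close>, and \<open>\<pi> s n d / 2\<close> is compared with
  \<open>2 \<pi> s h\<close>.
\<close>

lemma phase_difference_le:
  fixes n h :: int and l s d c :: real
  assumes "odd n" and l: "l \<in> {1, -1}" and s: "s \<in> {1, -1}"
  shows "norm (exp (- \<i> * of_real (pi * of_int n) * of_real ((l + c - 1 + s * d) / 2))
      - exp (- \<i> * of_real (pi * of_int n * c / 2)) * of_real l)
    \<le> 2 * \<bar>of_int n * d - 4 * of_int h\<bar>"
proof -
  define \<gamma> where "\<gamma> = exp (- \<i> * of_real (pi * of_int n * c / 2))"
  define \<theta> where "\<theta> = - s * (pi / 2) * (of_int n * d - 4 * of_int h)"
  obtain k where n: "n = 2 * k + 1" using \<open>odd n\<close> by (auto elim: oddE)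
  have period: "exp (z + \<i> * (of_int (2 * j) * of_real pi)) = exp z" for z and j :: int
    using exp_plus_2pin[of z j] by (simp add: mult_ac)
  have unit: "exp (\<i> * (of_int (2 * j) * of_real pi)) = 1" for j :: int
    using period[of 0 j] by (simp only: add_0 exp_zero)
  obtain j :: int where j: "s = of_int j"
    using s by (metis insertE of_int_1 of_int_minus singletonD)
  have ll: "exp (- \<i> * of_real (pi * of_int n * (l - 1) / 2)) = of_real l"
  proof (cases "l = 1")
    case False
    then have "l = -1" using l by simp
    then have eq: "- \<i> * of_real (pi * of_int n * (l - 1) / 2)
        = \<i> * of_real pi + \<i> * (of_int (2 * k) * of_real pi)"
      by (simp add: n algebra_simps)
    show ?thesis unfolding eq period using \<open>l = -1\<close> by simp
  qed simp
  \<comment> \<open>The identity is first proved over the reals and then multiplied by \<open>- \<i>\<close>.\<close>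
  have "pi * of_int n * ((l + c - 1 + s * d) / 2)
      = pi * of_int n * c / 2 + pi * of_int n * (l - 1) / 2 - \<theta> + of_int (2 * (j * h)) * pi"
    by (simp add: \<theta>_def j field_simps)
  then have "- \<i> * of_real (pi * of_int n * ((l + c - 1 + s * d) / 2))
      = - \<i> * of_real (pi * of_int n * c / 2 + pi * of_int n * (l - 1) / 2 - \<theta> + of_int (2 * (j * h)) * pi)"
    by (rule arg_cong)
  then have "- \<i> * of_real (pi * of_int n) * of_real ((l + c - 1 + s * d) / 2)
      = - \<i> * of_real (pi * of_int n * c / 2) + - \<i> * of_real (pi * of_int n * (l - 1) / 2)
        + (\<i> * of_real \<theta> + \<i> * (of_int (2 * (- (j * h))) * of_real pi))"
    by (simp only: of_real_mult of_real_add of_real_diff of_int_minus of_real_of_int_eq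
        distrib_left right_diff_distrib mult_minus_left mult_minus_right minus_minus mult.assoc)
      (simp only: diff_conv_add_uminus minus_minus add.assoc)
  then have "exp (- \<i> * of_real (pi * of_int n) * of_real ((l + c - 1 + s * d) / 2))
      = \<gamma> * of_real l * exp (\<i> * of_real \<theta>)"
    by (simp only: exp_add ll \<gamma>_def unit mult_1_right)
  then have "exp (- \<i> * of_real (pi * of_int n) * of_real ((l + c - 1 + s * d) / 2)) - \<gamma> * of_real l
      = \<gamma> * of_real l * (exp (\<i> * of_real \<theta>) - 1)"
    by (simp add: algebra_simps)
  moreover have "norm \<gamma> = 1" by (simp add: \<gamma>_def)
  moreover have "norm (of_real l :: complex) = 1" using l by auto
  ultimately have "norm (exp (- \<i> * of_real (pi * of_int n) * of_real ((l + c - 1 + s * d) / 2))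
      - \<gamma> * of_real l) = 2 * \<bar>sin (\<theta> / 2)\<bar>"
    by (simp only: norm_mult dist_exp_i_1)
  also have "\<dots> \<le> 2 * \<bar>\<theta> / 2\<bar>" by (intro mult_left_mono abs_sin_x_le_abs_x) auto
  also have "\<dots> = pi / 2 * \<bar>of_int n * d - 4 * of_int h\<bar>"
    using s by (auto simp: \<theta>_def abs_mult)
  also have "\<dots> \<le> 2 * \<bar>of_int n * d - 4 * of_int h\<bar>"
    using pi_less_4 by (intro mult_right_mono) auto
  finally show ?thesis unfolding \<gamma>_def .
qed

theorem theorem5p1:
  fixes G :: "('a::finite, 'e) pre_digraph" and H :: "('b::finite, 'f) pre_digraph"
    and m :: nat and u v :: 'a
  assumes "m \<ge> 1"
    and "K\<^bsub>2\<^esub> G" and "K\<^bsub>m\<^esub> H"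
    and "verts G = {u, v}"
  shows "pretty_good_state_transfer (with_proj (corona G H)) (u, None) (v, None)"
proof -
  have "card {u, v} = 2" using assms(2,4) by (simp add: complete_digraph_def)
  then have "u \<noteq> v" by auto
  define t :: "real \<Rightarrow> real" where "t l = real m - 1 - l" for l
  define d where "d l = sqrt ((t l)\<^sup>2 + 4 * real m)" for l
  define J :: "(real \<times> real) set" where "J = {1, -1} \<times> {1, -1}"
  define \<mu> where "\<mu> = (\<lambda>(l, s). (l + real m - 1 + s * d l) / 2)"
  \<comment> \<open>The pair \<open>(l, s)\<close> stands for the symmetry \<open>l\<close> under exchanging \<open>u\<close> and \<open>v\<close>, and the sign \<open>s\<close> of the square root.\<close>
  \<comment> \<open>The eigenvectors are scaled so that for each \<open>l\<close> the two of them add up to the values 1/2 at \<open>(u, None)\<close> and 0 on the copies of \<open>H\<close>.\<close>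
  define f where "f = (\<lambda>(l, s). corona_vector u v (verts H) l ((1 - s * t l / d l) / 4) (s / (2 * d l)))"
  have d2: "(d l)\<^sup>2 = (t l)\<^sup>2 + 4 * real m" for l
    by (simp add: d_def)
  have dpos: "d l > 0" for l
    using assms(1) by (simp add: d_def add_nonneg_pos)
  have d1: "d 1 = sqrt (real (m\<^sup>2 + 4))" and dm1: "d (-1) = sqrt (real (m\<^sup>2 + 4 * m))"
    by (simp_all add: d_def t_def power2_eq_square algebra_simps)
  have vert: "(u, None) \<in> verts (with_proj (corona G H))" "(v, None) \<in> verts (with_proj (corona G H))"
    by (simp_all add: corona_def assms(4))
  have sumJ: "(\<Sum>j\<in>J. g j) = (g (1, 1) + g (1, -1)) + (g (-1, 1) + g (-1, -1))"
    for g :: "real \<times> real \<Rightarrow> complex ^ ('a \<times> 'b option)"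
  proof -
    have J: "J = {(1, 1), (1, -1), (-1, 1), (-1, -1)}" by (auto simp: J_def)
    show ?thesis unfolding J by (simp add: add.assoc)
  qed
  have fadd: "f (l, 1) + f (l, -1) = corona_vector u v (verts H) l (1/2) 0" for l
  proof -
    have half: "(1 - r) / 4 + (1 + r) / 4 = 1 / 2" for r :: real by (simp add: field_simps)
    show ?thesis by (simp add: f_def corona_vector_add half)
  qed
  show ?thesis
  proof (rule pretty_good_state_transferI_eigenvectors[where J = J and f = f and \<mu> = \<mu>
        and \<sigma> = "\<lambda>j. of_real (fst j)", OF vert])
    fix j assume "j \<in> J"
    then obtain l s where j: "j = (l, s)" and l: "l\<^sup>2 = 1" and s: "s = 1 \<or> s = -1"
      by (auto simp: J_def)
    have q: "(1 - s * t l / d l) / 4 + (real m - 1) * (s / (2 * d l)) = \<mu> j * (s / (2 * d l))"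
      using dpos[of l] s by (auto simp: \<mu>_def j t_def field_simps)
    have "l * ((1 - s * t l / d l) / 4) + real m * (s / (2 * d l)) - \<mu> j * ((1 - s * t l / d l) / 4)
      = s * ((t l)\<^sup>2 + 4 * real m - (d l)\<^sup>2) / (8 * d l) "
      using dpos[of l] s by (auto simp: \<mu>_def j t_def field_simps power2_eq_square)
    then have p: "l * ((1 - s * t l / d l) / 4) + real m * (s / (2 * d l)) = \<mu> j * ((1 - s * t l / d l) / 4)"
      using d2[of l] by simp
    show "adjacency_matrix (with_proj (corona G H)) *v f j = of_real (\<mu> j) *s f j"
      using corona_vector_eigenvector[OF assms(2-4) l p q] by (simp add: f_def j)
  next
    show "axis (u, None) 1 = (\<Sum>j\<in>J. f j)"
      unfolding sumJ fadd by (rule axis_eq_corona_vector(1)[OF \<open>u \<noteq> v\<close>])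
  next
    have "(\<Sum>j\<in>J. of_real (fst j) *s f j) = (f (1, 1) + f (1, -1)) - (f (-1, 1) + f (-1, -1))"
      unfolding sumJ by (simp add: vector_smult_lneg)
    then show "axis (v, None) 1 = (\<Sum>j\<in>J. of_real (fst j) *s f j)"
      unfolding fadd by (simp add: axis_eq_corona_vector(2)[OF \<open>u \<noteq> v\<close>, of "verts H"])
  next
    fix \<delta> :: real assume "\<delta> > 0"
    have "d 1 \<notin> \<rat>" "(d 1)\<^sup>2 \<in> \<rat>" "d (-1) \<notin> \<rat>" "(d (-1))\<^sup>2 \<in> \<rat>"
      unfolding d1 dm1
      using sqrt_square_plus_4_irrational[OF assms(1)] sqrt_square_plus_4_times_irrational[OF assms(1)]
      by (simp_all del: of_nat_add of_nat_mult of_nat_power)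
    then obtain n h k :: int where n: "odd n"
      and h: "\<bar>of_int n * d 1 - 4 * of_int h\<bar> < \<delta> / 2" and k: "\<bar>of_int n * d (-1) - 4 * of_int k\<bar> < \<delta> / 2"
      using odd_multiples_near_multiples_of_4[of "d 1" "d (-1)" "\<delta> / 2"] \<open>\<delta> > 0\<close> by auto
    have "norm (exp (- \<i> * of_real (pi * of_int n) * of_real (\<mu> j))
        - exp (- \<i> * of_real (pi * of_int n * real m / 2)) * of_real (fst j)) \<le> \<delta>" if jJ: "j \<in> J" for j
    proof -
      obtain l s where j: "j = (l, s)" and l: "l \<in> {1, -1}" and s: "s \<in> {1, -1}"
        using jJ by (auto simp: J_def)
      obtain i where "\<bar>of_int n * d l - 4 * of_int i\<bar> < \<delta> / 2" using h k l by auto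
      with phase_difference_le[OF n l s, of "real m" "d l" i] show ?thesis
        by (simp add: j \<mu>_def)
    qed
    then show "\<exists>(\<tau>::real) (\<gamma>::complex). norm \<gamma> = 1 \<and>
        (\<forall>j\<in>J. norm (exp (- \<i> * of_real \<tau> * of_real (\<mu> j)) - \<gamma> * of_real (fst j)) \<le> \<delta>)"
      by (intro exI[of _ "pi * of_int n"] exI[of _ "exp (- \<i> * of_real (pi * of_int n * real m / 2))"]) auto
  qed
qed

end
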